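(* Let $\Gamma=(a,\{m_p:d_p\}_{p\in a})$ be a connector motif of a simple architecture diagram, with $a=\{p^1,\dots,p^v\}$, such that all generic ports of $a$ have the same integer matching factor $s$. For each $j\in[1,v]$, let $w^j=\binom{n_{p^j}}{m_{p^j}}$, let $a^j_1,\dots,a^j_{w^j}$ be the distinct sets of exactly $m_{p^j}$ instances of $p^j$, let $G^j$ be the $n_{p^j}\times w^j$ incidence matrix with entry $g^j_{i,h}=1$ if the $i$-th instance of $p^j$ belongs to $a^j_h$ and $g^j_{i,h}=0$ otherwise, and let $D^j=[d_{p^j},\dots,d_{p^j}]^T$ (of length $n_{p^j}$). Let $E=[e_{i_1,\dots,i_v}]_{w^1\times\dots\times w^v}$ be a $v$-dimensional matrix with entries in $\{0,1\}$, and let $\gamma_E$ be the set of connectors $a^1_{i_1}\cup\dots\cup a^v_{i_v}$ with $e_{i_1,\dots,i_v}=1$. Then $\gamma_E$ is a configuration conforming to $\Gamma$ if and only if there exist vectors of non-negative integers $X^j=[x^j_1,\dots,x^j_{w^j}]^T$, $j\in[1,v]$, such that $G^jX^j=D^j$ for all $j\in[1,v]$ and $$x^j_i=\sum_{\substack{i_1,\dots,i_v\\ i_j=i}} e_{i_1,\dots,i_v}\qquad\text{for all } j\in[1,v],\ i\in[1,w^j].$$ Moreover, every configuration conforming to $\Gamma$ is of the form $\gamma_E$ for some such $E$.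
   Context: In a simple architecture diagram, each component type $T$ has a set of generic ports and a cardinality $n(T)$ (a positive integer); distinct types have disjoint sets of generic ports. For a generic port $p$ of type $T$, $n_p=n(T)$, and $p$ has $n_p$ distinct port instances $p_1,\dots,p_{n_p}$ (instances of different generic ports are distinct). A connector motif is $\Gamma=(a,\{m_p:d_p\}_{p\in a})$, where $a$ is a non-empty set of generic ports and $m_p$ (multiplicity), $d_p$ (degree) are positive integers. The matching factor of $p\in a$ is $s_p=n_p\cdot d_p/m_p$. A connector is a set of port instances. A configuration conforming to (specified by) $\Gamma$ is a set of connectors, each consisting only of instances of generic ports in $a$, such that for each $p\in a$: each connector contains exactly $m_p$ instances of $p$, and each instance of $p$ belongs to exactly $d_p$ connectors of the configuration. *)

theory Defs
  imports "Jordan_Normal_Form.Matrix"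
begin

record 'p motif =
  motif_ports :: "'p set"
  motif_mult :: "'p \<Rightarrow> nat"
  motif_deg :: "'p \<Rightarrow> nat"

record ('t, 'p) architecture_diagram =
  component_types :: "'t set"
  generic_ports :: "'t \<Rightarrow> 'p set"
  cardinality :: "'t \<Rightarrow> nat"
  connector_motifs :: "'p motif set"

definition all_ports :: "('t, 'p) architecture_diagram \<Rightarrow> 'p set" where
  "all_ports \<D> = (\<Union>T\<in>component_types \<D>. generic_ports \<D> T)"

definition connector_motif :: "('t, 'p) architecture_diagram \<Rightarrow> 'p motif \<Rightarrow> bool" where
  "connector_motif \<D> \<Gamma> \<longleftrightarrow>
     motif_ports \<Gamma> \<noteq> {} \<and> motif_ports \<Gamma> \<subseteq> all_ports \<D> \<and>
     (\<forall>q\<in>motif_ports \<Gamma>. motif_mult \<Gamma> q > 0 \<and> motif_deg \<Gamma> q > 0)"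

definition simple_architecture_diagram :: "('t, 'p) architecture_diagram \<Rightarrow> bool" where
  "simple_architecture_diagram \<D> \<longleftrightarrow>
     (\<forall>T\<in>component_types \<D>. cardinality \<D> T > 0) \<and>
     (\<forall>T\<in>component_types \<D>. \<forall>T'\<in>component_types \<D>.
        T \<noteq> T' \<longrightarrow> generic_ports \<D> T \<inter> generic_ports \<D> T' = {}) \<and>
     (\<forall>\<Gamma>\<in>connector_motifs \<D>. connector_motif \<D> \<Gamma>)"

text \<open>The type of a generic port is unique because distinct types have disjoint port sets.\<close>

definition port_type :: "('t, 'p) architecture_diagram \<Rightarrow> 'p \<Rightarrow> 't" where
  "port_type \<D> q = (THE T. T \<in> component_types \<D> \<and> q \<in> generic_ports \<D> T)"

definition port_card :: "('t, 'p) architecture_diagram \<Rightarrow> 'p \<Rightarrow> nat" where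
  "port_card \<D> q = cardinality \<D> (port_type \<D> q)"

text \<open>
  The instances of a generic port \<open>q\<close> are the pairs \<open>(q, i)\<close> with \<open>i < port_card \<D> q\<close>.
  All enumerations start at 0, as do the rows and columns of the library's matrices.
\<close>

definition instances :: "('t, 'p) architecture_diagram \<Rightarrow> 'p \<Rightarrow> ('p \<times> nat) set" where
  "instances \<D> q = {(q, i) | i. i < port_card \<D> q}"

definition matching_factor :: "('t, 'p) architecture_diagram \<Rightarrow> 'p motif \<Rightarrow> 'p \<Rightarrow> rat" where
  "matching_factor \<D> \<Gamma> q =
     of_nat (port_card \<D> q) * of_nat (motif_deg \<Gamma> q) / of_nat (motif_mult \<Gamma> q)"

type_synonym 'p connector = "('p \<times> nat) set"

definition conforms ::
  "('t, 'p) architecture_diagram \<Rightarrow> 'p motif \<Rightarrow> 'p connector set \<Rightarrow> bool" where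
  "conforms \<D> \<Gamma> \<gamma> \<longleftrightarrow>
     (\<forall>c\<in>\<gamma>. c \<subseteq> (\<Union>q\<in>motif_ports \<Gamma>. instances \<D> q)) \<and>
     (\<forall>q\<in>motif_ports \<Gamma>.
        (\<forall>c\<in>\<gamma>. card (c \<inter> instances \<D> q) = motif_mult \<Gamma> q) \<and>
        (\<forall>x\<in>instances \<D> q. card {c \<in> \<gamma>. x \<in> c} = motif_deg \<Gamma> q))"

text \<open>
  A \<open>v\<close>-dimensional matrix of size \<open>w 0 \<times> \<dots> \<times> w (v - 1)\<close> is a function on index tuples;
  only its values on \<open>multi_indices v w\<close> are relevant.
\<close>

definition multi_indices :: "nat \<Rightarrow> (nat \<Rightarrow> nat) \<Rightarrow> (nat \<Rightarrow> nat) set" where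
  "multi_indices v w = (\<Pi>\<^sub>E j\<in>{..<v}. {..<w j})"

definition zero_one_matrix :: "nat \<Rightarrow> (nat \<Rightarrow> nat) \<Rightarrow> ((nat \<Rightarrow> nat) \<Rightarrow> nat) \<Rightarrow> bool" where
  "zero_one_matrix v w E \<longleftrightarrow> (\<forall>\<iota>\<in>multi_indices v w. E \<iota> \<in> {0, 1})"

text \<open>Here \<open>a j h\<close> is the \<open>h\<close>-th set of instances of the \<open>j\<close>-th port.\<close>

definition induced_configuration ::
  "nat \<Rightarrow> (nat \<Rightarrow> nat) \<Rightarrow> (nat \<Rightarrow> nat \<Rightarrow> 'p connector) \<Rightarrow> ((nat \<Rightarrow> nat) \<Rightarrow> nat) \<Rightarrow> 'p connector set"
  where
  "induced_configuration v w a E =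
     {(\<Union>j<v. a j (\<iota> j)) | \<iota>. \<iota> \<in> multi_indices v w \<and> E \<iota> = 1}"

end

theory Submission
  imports Defs
begin

text \<open>
  The instance sets of distinct ports are disjoint, so a connector \<open>a\<^sup>1\<^sub>i\<^sub>1 \<union> \<dots> \<union> a\<^sup>v\<^sub>i\<^sub>v\<close> meets the
  instances of \<open>p\<^sup>j\<close> exactly in \<open>a\<^sup>j\<^sub>i\<^sub>j\<close>. Hence index tuples correspond bijectively to the sets with
  the prescribed multiplicities, and the \<open>i\<close>-th entry of \<open>G\<^sup>j X\<^sup>j\<close>, for \<open>X\<^sup>j\<close> the \<open>j\<close>-th marginal of
  \<open>E\<close>, counts the connectors of \<open>\<gamma>\<^sub>E\<close> through the \<open>i\<close>-th instance of \<open>p\<^sup>j\<close>.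
\<close>

lemma finite_multi_indices: "finite (multi_indices v w)"
  by (simp add: multi_indices_def finite_PiE)

lemma multi_indices_less: "\<iota> \<in> multi_indices v w \<Longrightarrow> j < v \<Longrightarrow> \<iota> j < w j"
  by (auto simp: multi_indices_def)

text \<open>Separates the formation of a connector from the choice of tuples:
  \<open>induced_configuration\<close> becomes an image under a map, so that counting connectors
  reduces to injectivity of that map.\<close>

definition tuple_union :: "nat \<Rightarrow> (nat \<Rightarrow> nat \<Rightarrow> 'p connector) \<Rightarrow> (nat \<Rightarrow> nat) \<Rightarrow> 'p connector"
  where
  "tuple_union v a \<iota> = (\<Union>j<v. a j (\<iota> j))"

lemma induced_configuration_eq:
  "induced_configuration v w a E = tuple_union v a ` {\<iota> \<in> multi_indices v w. E \<iota> = 1}"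
  by (auto simp: induced_configuration_def tuple_union_def)

lemma sum_zero_one_eq_card:
  fixes f :: "'a \<Rightarrow> nat"
  assumes "finite A" "\<And>x. x \<in> A \<Longrightarrow> f x \<in> {0, 1}"
  shows "sum f A = card {x \<in> A. f x = 1}"
proof -
  have "sum f A = (\<Sum>x\<in>A. if f x = 1 then 1 else 0)"
    using assms(2) by (intro sum.cong) auto
  then show ?thesis
    using assms(1) by (simp add: sum.If_cases Int_def)
qed

text \<open>Group the tuples by their \<open>j\<close>-th coordinate: \<open>P (\<iota> j)\<close>
  is constant on each group. With \<open>P h\<close> chosen as \<open>x \<in> a j h\<close>, the
  right-hand side is a row of the incidence matrix times the vector of marginals.\<close>

lemma sum_multi_indices_marginal:
  fixes E :: "(nat \<Rightarrow> nat) \<Rightarrow> nat"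
  assumes "j < v"
  shows "(\<Sum>\<iota>\<in>{\<iota> \<in> multi_indices v w. P (\<iota> j)}. E \<iota>) =
    (\<Sum>h<w j. (if P h then 1 else 0) * (\<Sum>\<iota>\<in>{\<iota> \<in> multi_indices v w. \<iota> j = h}. E \<iota>))"
proof -
  let ?S = "{\<iota> \<in> multi_indices v w. P (\<iota> j)}"
  have "sum E ?S = (\<Sum>h<w j. \<Sum>\<iota>\<in>{\<iota> \<in> ?S. \<iota> j = h}. E \<iota>)"
    by (rule sum.group [symmetric])
      (auto simp: finite_multi_indices multi_indices_less [OF _ assms])
  also have "\<dots> = (\<Sum>h<w j. (if P h then 1 else 0) *
      (\<Sum>\<iota>\<in>{\<iota> \<in> multi_indices v w. \<iota> j = h}. E \<iota>))"
  proof (rule sum.cong [OF refl])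
    fix h
    have eq: "{\<iota> \<in> ?S. \<iota> j = h} = (if P h then {\<iota> \<in> multi_indices v w. \<iota> j = h} else {})"
      by auto
    show "(\<Sum>\<iota>\<in>{\<iota> \<in> ?S. \<iota> j = h}. E \<iota>) =
        (if P h then 1 else 0) * (\<Sum>\<iota>\<in>{\<iota> \<in> multi_indices v w. \<iota> j = h}. E \<iota>)"
      unfolding eq by simp
  qed
  finally show ?thesis .
qed

text \<open>Keeps just the combinatorics of the diagram: \<open>B j\<close> stands for the instances
  of the \<open>j\<close>-th port and \<open>m j\<close> for its multiplicity.\<close>

locale subset_enumeration =
  fixes v :: nat and B :: "nat \<Rightarrow> ('p \<times> nat) set" and m w :: "nat \<Rightarrow> nat"
    and a :: "nat \<Rightarrow> nat \<Rightarrow> 'p connector"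
  assumes disjoint: "disjoint_family_on B {..<v}"
    and enum: "j < v \<Longrightarrow> bij_betw (a j) {..<w j} {S. S \<subseteq> B j \<and> card S = m j}"
begin

lemma enum_subset: "j < v \<Longrightarrow> h < w j \<Longrightarrow> a j h \<subseteq> B j"
  and enum_card: "j < v \<Longrightarrow> h < w j \<Longrightarrow> card (a j h) = m j"
  using bij_betwE [OF enum] by blast+

lemma tuple_union_subset: "\<iota> \<in> multi_indices v w \<Longrightarrow> tuple_union v a \<iota> \<subseteq> (\<Union>j<v. B j)"
  unfolding tuple_union_def by (intro UN_mono enum_subset) (auto simp: multi_indices_less)

lemma tuple_union_Int:
  assumes \<iota>: "\<iota> \<in> multi_indices v w" and j: "j < v"
  shows "tuple_union v a \<iota> \<inter> B j = a j (\<iota> j)"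
proof -
  have "a k (\<iota> k) \<inter> B j = {}" if "k < v" "k \<noteq> j" for k
  proof -
    have "B k \<inter> B j = {}"
      using disjoint that j by (auto simp: disjoint_family_on_def)
    then show ?thesis
      using enum_subset [OF that(1) multi_indices_less [OF \<iota> that(1)]] by blast
  qed
  moreover have "a j (\<iota> j) \<subseteq> B j"
    using enum_subset multi_indices_less \<iota> j by blast
  ultimately show ?thesis
    using j unfolding tuple_union_def by blast
qed

text \<open>Intersecting the union with \<open>B j\<close> recovers \<open>a j (\<iota> j)\<close>,
  and the enumeration \<open>a j\<close> is injective, so every coordinate can be read off.\<close>

lemma inj_on_tuple_union: "inj_on (tuple_union v a) (multi_indices v w)"
proof (rule inj_onI)
  fix \<iota> \<kappa>
  assume \<iota>: "\<iota> \<in> multi_indices v w" and \<kappa>: "\<kappa> \<in> multi_indices v w"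
    and eq: "tuple_union v a \<iota> = tuple_union v a \<kappa>"
  have "\<iota> j = \<kappa> j" if "j < v" for j
  proof (rule inj_onD [OF bij_betw_imp_inj_on [OF enum [OF that]]])
    show "a j (\<iota> j) = a j (\<kappa> j)"
      using tuple_union_Int [OF \<iota> that] tuple_union_Int [OF \<kappa> that] eq by simp
  qed (use multi_indices_less \<iota> \<kappa> that in auto)
  then show "\<iota> = \<kappa>"
    using \<iota> \<kappa> unfolding multi_indices_def by (intro PiE_ext) auto
qed

lemma tuple_union_surj:
  assumes c: "c \<subseteq> (\<Union>j<v. B j)" "\<And>j. j < v \<Longrightarrow> card (c \<inter> B j) = m j"
  obtains \<iota> where "\<iota> \<in> multi_indices v w" "tuple_union v a \<iota> = c"
proof -
  have "\<exists>h<w j. a j h = c \<inter> B j" if "j < v" for j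
  proof -
    have "c \<inter> B j \<in> a j ` {..<w j}"
      using bij_betw_imp_surj_on [OF enum [OF that]] c(2) [OF that] by simp
    then show ?thesis
      by force
  qed
  then obtain f where f: "\<And>j. j < v \<Longrightarrow> f j < w j \<and> a j (f j) = c \<inter> B j"
    by metis
  show thesis
  proof
    \<comment> \<open>The restriction is essential: members of \<open>PiE\<close> are
      \<open>undefined\<close> outside the index set.\<close>
    show "restrict f {..<v} \<in> multi_indices v w"
      using f by (auto simp: multi_indices_def)
    show "tuple_union v a (restrict f {..<v}) = c"
      using f c(1) by (auto simp: tuple_union_def)
  qed
qed

text \<open>By injectivity, connectors through \<open>x\<close> may be counted as tuples, and tuples
  as a sum of 0/1 entries; grouping that sum by the \<open>j\<close>-th coordinate gives the
  marginals.\<close>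

lemma card_induced_through:
  assumes E: "zero_one_matrix v w E" and j: "j < v" and x: "x \<in> B j"
  shows "card {c \<in> induced_configuration v w a E. x \<in> c} =
    (\<Sum>h<w j. (if x \<in> a j h then 1 else 0) *
      (\<Sum>\<iota>\<in>{\<iota> \<in> multi_indices v w. \<iota> j = h}. E \<iota>))"
proof -
  let ?S = "{\<iota> \<in> multi_indices v w. x \<in> a j (\<iota> j)}"
  have mem: "x \<in> tuple_union v a \<iota> \<longleftrightarrow> x \<in> a j (\<iota> j)" if "\<iota> \<in> multi_indices v w" for \<iota>
    using tuple_union_Int [OF that j] x by blast
  have "{c \<in> induced_configuration v w a E. x \<in> c} = tuple_union v a ` {\<iota> \<in> ?S. E \<iota> = 1}"
    using mem by (auto simp: induced_configuration_eq)
  moreover have "inj_on (tuple_union v a) {\<iota> \<in> ?S. E \<iota> = 1}"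
    by (rule inj_on_subset [OF inj_on_tuple_union]) auto
  ultimately have "card {c \<in> induced_configuration v w a E. x \<in> c} = card {\<iota> \<in> ?S. E \<iota> = 1}"
    by (simp add: card_image)
  also have "\<dots> = sum E ?S"
    using E by (intro sum_zero_one_eq_card [symmetric])
      (auto simp: finite_multi_indices zero_one_matrix_def)
  also have "\<dots> = (\<Sum>h<w j. (if x \<in> a j h then 1 else 0) *
      (\<Sum>\<iota>\<in>{\<iota> \<in> multi_indices v w. \<iota> j = h}. E \<iota>))"
    by (rule sum_multi_indices_marginal [OF j])
  finally show ?thesis .
qed

lemma exists_induced_configuration:
  assumes "\<And>c. c \<in> \<gamma> \<Longrightarrow> c \<subseteq> (\<Union>j<v. B j)"
    and "\<And>c j. c \<in> \<gamma> \<Longrightarrow> j < v \<Longrightarrow> card (c \<inter> B j) = m j"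
  shows "\<exists>E. zero_one_matrix v w E \<and> \<gamma> = induced_configuration v w a E"
proof (intro exI conjI)
  \<comment> \<open>The indicator of \<open>\<gamma>\<close>, pulled back along
    \<open>tuple_union\<close>. Equality with \<open>\<gamma>\<close> then amounts to every
    connector of \<open>\<gamma>\<close> being the union of some tuple.\<close>
  let ?E = "\<lambda>\<iota>. if tuple_union v a \<iota> \<in> \<gamma> then 1 else 0 :: nat"
  show "zero_one_matrix v w ?E"
    by (simp add: zero_one_matrix_def)
  have "c \<in> tuple_union v a ` multi_indices v w" if c: "c \<in> \<gamma>" for c
    using assms [OF c] by (metis imageI tuple_union_surj)
  then show "\<gamma> = induced_configuration v w a ?E"
    unfolding induced_configuration_eq by auto
qed

end

theorem mainTheorem5:
  fixes \<D> :: "('t, 'p) architecture_diagram"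
    and \<Gamma> :: "'p motif"
    and p :: "nat \<Rightarrow> 'p"
    and v :: nat
    and s :: int
    and w :: "nat \<Rightarrow> nat"
    and a :: "nat \<Rightarrow> nat \<Rightarrow> 'p connector"
    and G :: "nat \<Rightarrow> nat mat"
    and D :: "nat \<Rightarrow> nat vec"
  assumes "simple_architecture_diagram \<D>"
    and "\<Gamma> \<in> connector_motifs \<D>"
    and "bij_betw p {..<v} (motif_ports \<Gamma>)"
    and "\<forall>q\<in>motif_ports \<Gamma>. matching_factor \<D> \<Gamma> q = of_int s"
    and "\<forall>j<v. w j = port_card \<D> (p j) choose motif_mult \<Gamma> (p j)"
    and "\<forall>j<v. bij_betw (a j) {..<w j}
           {S. S \<subseteq> instances \<D> (p j) \<and> card S = motif_mult \<Gamma> (p j)}"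
    and "\<forall>j<v. G j = mat (port_card \<D> (p j)) (w j)
           (\<lambda>(i, h). if (p j, i) \<in> a j h then 1 else 0)"
    and "\<forall>j<v. D j = vec (port_card \<D> (p j)) (\<lambda>_. motif_deg \<Gamma> (p j))"
  shows "(\<forall>E. zero_one_matrix v w E \<longrightarrow>
            (conforms \<D> \<Gamma> (induced_configuration v w a E) \<longleftrightarrow>
             (\<exists>X :: nat \<Rightarrow> nat vec.
                (\<forall>j<v. X j \<in> carrier_vec (w j)) \<and>
                (\<forall>j<v. G j *\<^sub>v X j = D j) \<and>
                (\<forall>j<v. \<forall>i<w j. X j $ i = (\<Sum>\<iota>\<in>{\<iota> \<in> multi_indices v w. \<iota> j = i}. E \<iota>))))) \<and>
         (\<forall>\<gamma>. conforms \<D> \<Gamma> \<gamma> \<longrightarrow>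
            (\<exists>E. zero_one_matrix v w E \<and> \<gamma> = induced_configuration v w a E))"
proof -
  let ?I = "\<lambda>j. instances \<D> (p j)"
  let ?n = "\<lambda>j. port_card \<D> (p j)"
  let ?m = "\<lambda>j. motif_mult \<Gamma> (p j)"
  have ports: "motif_ports \<Gamma> = p ` {..<v}" and "inj_on p {..<v}"
    using assms(3) by (auto simp: bij_betw_def)
  \<comment> \<open>An instance carries its port as first component, and \<open>p\<close> is
    injective.\<close>
  then have "disjoint_family_on ?I {..<v}"
    by (auto simp: disjoint_family_on_def instances_def inj_on_def)
  then interpret subset_enumeration v ?I ?m w a
    using assms(6) by unfold_locales auto
  have conforms_iff: "conforms \<D> \<Gamma> \<gamma> \<longleftrightarrow>
      (\<forall>c\<in>\<gamma>. c \<subseteq> (\<Union>j<v. ?I j)) \<and> (\<forall>j<v. \<forall>c\<in>\<gamma>. card (c \<inter> ?I j) = ?m j) \<and>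
      (\<forall>j<v. \<forall>i<?n j. card {c \<in> \<gamma>. (p j, i) \<in> c} = motif_deg \<Gamma> (p j))" for \<gamma>
    unfolding conforms_def ports by (auto simp: instances_def)
  show ?thesis
  proof (intro conjI allI impI)
    fix E
    assume E: "zero_one_matrix v w E"
    let ?\<gamma> = "induced_configuration v w a E"
    let ?x = "\<lambda>j i. \<Sum>\<iota>\<in>{\<iota> \<in> multi_indices v w. \<iota> j = i}. E \<iota>"
    \<comment> \<open>Unions of tuples satisfy the containment and multiplicity conditions for every
      \<open>E\<close>; what remains is the degree condition.\<close>
    have "conforms \<D> \<Gamma> ?\<gamma> \<longleftrightarrow>
        (\<forall>j<v. \<forall>i<?n j. card {c \<in> ?\<gamma>. (p j, i) \<in> c} = motif_deg \<Gamma> (p j))"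
    proof -
      have "c \<subseteq> (\<Union>j<v. ?I j)" if "c \<in> ?\<gamma>" for c
        using that tuple_union_subset by (auto simp: induced_configuration_eq)
      moreover have "card (c \<inter> ?I j) = ?m j" if "j < v" "c \<in> ?\<gamma>" for j c
        using that by (auto simp: induced_configuration_eq tuple_union_Int enum_card multi_indices_less)
      ultimately show ?thesis
        unfolding conforms_iff by blast
    qed
    also have "\<dots> \<longleftrightarrow> (\<forall>j<v. \<forall>i<?n j.
        (\<Sum>h<w j. (if (p j, i) \<in> a j h then 1 else 0) * ?x j h) = motif_deg \<Gamma> (p j))"
      using card_induced_through [OF E] by (simp add: instances_def)
    \<comment> \<open>For fixed \<open>j\<close>, the equations for the single instances are the
      rows of one matrix equation.\<close>
    also have "\<dots> \<longleftrightarrow> (\<forall>j<v. G j *\<^sub>v vec (w j) (?x j) = D j)"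
    proof -
      have "G j *\<^sub>v vec (w j) (?x j) = D j \<longleftrightarrow> (\<forall>i<?n j.
          (\<Sum>h<w j. (if (p j, i) \<in> a j h then 1 else 0) * ?x j h) = motif_deg \<Gamma> (p j))"
        if "j < v" for j
        using assms(7,8) that
        by (simp add: vec_eq_iff scalar_prod_def atLeast0LessThan)
      then show ?thesis
        by simp
    qed
    \<comment> \<open>The dimension and the prescribed entries determine \<open>X j\<close> for
      \<open>j < v\<close>, so the existential has the marginal vectors as its only possible
      witnesses there.\<close>
    also have "\<dots> \<longleftrightarrow> (\<exists>X. (\<forall>j<v. X j \<in> carrier_vec (w j)) \<and> (\<forall>j<v. G j *\<^sub>v X j = D j) \<and>
        (\<forall>j<v. \<forall>i<w j. X j $ i = ?x j i))"
    proof
      assume "\<forall>j<v. G j *\<^sub>v vec (w j) (?x j) = D j"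
      then show "\<exists>X. (\<forall>j<v. X j \<in> carrier_vec (w j)) \<and> (\<forall>j<v. G j *\<^sub>v X j = D j) \<and>
          (\<forall>j<v. \<forall>i<w j. X j $ i = ?x j i)"
        by (intro exI [of _ "\<lambda>j. vec (w j) (?x j)"]) simp
    next
      assume "\<exists>X. (\<forall>j<v. X j \<in> carrier_vec (w j)) \<and> (\<forall>j<v. G j *\<^sub>v X j = D j) \<and>
          (\<forall>j<v. \<forall>i<w j. X j $ i = ?x j i)"
      then obtain X where X: "\<forall>j<v. X j \<in> carrier_vec (w j)" "\<forall>j<v. G j *\<^sub>v X j = D j"
        "\<forall>j<v. \<forall>i<w j. X j $ i = ?x j i"
        by blast
      have "X j = vec (w j) (?x j)" if "j < v" for j
        using X(1,3) that by (intro eq_vecI) auto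
      then show "\<forall>j<v. G j *\<^sub>v vec (w j) (?x j) = D j"
        using X(2) by simp
    qed
    finally show "conforms \<D> \<Gamma> ?\<gamma> \<longleftrightarrow>
        (\<exists>X. (\<forall>j<v. X j \<in> carrier_vec (w j)) \<and> (\<forall>j<v. G j *\<^sub>v X j = D j) \<and>
          (\<forall>j<v. \<forall>i<w j. X j $ i = ?x j i))" .
  next
    fix \<gamma>
    assume "conforms \<D> \<Gamma> \<gamma>"
    then show "\<exists>E. zero_one_matrix v w E \<and> \<gamma> = induced_configuration v w a E"
      unfolding conforms_iff by (intro exists_induced_configuration) simp_all
  qed
qed

end
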